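(* Let $K$ be a field of any characteristic. The Anick automorphism (with the fixed variable renamed $z$) $$\varphi=(x+z(xz-zy),\; y+(xz-zy)z)$$ of $K\langle x,y,z\rangle$, i.e. the $K$-algebra automorphism with $\varphi(x)=x+z(xz-zy)$, $\varphi(y)=y+(xz-zy)z$, $\varphi(z)=z$, is wild as a $K[z]$-automorphism; that is, $\varphi$ is not a tame $K[z]$-automorphism of $K\langle x,y,z\rangle$.
   Context: $K\langle x,y,z\rangle$ is the free associative (unital) $K$-algebra on $x,y,z$. A $K[z]$-automorphism of it is a $K$-algebra automorphism $\varphi$ with $\varphi(z)=z$, written as $\varphi=(\varphi(x),\varphi(y))$. The group of elementary linear automorphisms is generated by the $K[z]$-automorphisms $(\alpha_1x,\alpha_2y)$ with $\alpha_1,\alpha_2\in K^*$, together with $(x+a(z)\,y\,b(z),\,y)$ and $(x,\,y+a(z)\,x\,b(z))$ with $a,b\in K[z]$. The triangular $K[z]$-automorphisms are $(\alpha_1x+f_1(y,z),\,\alpha_2y+f_2(z))$ with $\alpha_1,\alpha_2\in K^*$, $f_1\in K\langle y,z\rangle$, $f_2\in K[z]$. A $K[z]$-automorphism is tame if it lies in the group generated by the elementary linear automorphisms and the triangular $K[z]$-automorphisms; otherwise it is wild. *)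

theory Defs
  imports "HOL-Library.Poly_Mapping" "HOL-Algebra.Generated_Groups"
begin

datatype letter = LX | LY | LZ

(* The free monoid. The multiplication of poly_mapping is the convolution over an
   additively written, not necessarily commutative, monoid of exponents; hence
   concatenation of words is written +, and the empty word 0. *)
datatype 'v word = Word (letters: "'v list")

instantiation word :: (type) monoid_add
begin

definition "0 = Word []"

definition "u + v = Word (letters u @ letters v)"

instance
  by standard (simp_all add: zero_word_def plus_word_def)

end

type_synonym 'k free_alg = "letter word \<Rightarrow>\<^sub>0 'k"

definition scal :: "'k \<Rightarrow> 'k::field free_alg"
  where "scal c = Poly_Mapping.single 0 c"

definition gen :: "letter \<Rightarrow> 'k::field free_alg"
  where "gen v = Poly_Mapping.single (Word [v]) 1"

abbreviation "X \<equiv> gen LX"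
abbreviation "Y \<equiv> gen LY"
abbreviation "Z \<equiv> gen LZ"

definition alg_over :: "letter set \<Rightarrow> 'k::field free_alg set"
  where "alg_over S = {p. \<forall>w \<in> Poly_Mapping.keys p. set (letters w) \<subseteq> S}"

definition alg_endo :: "('k::field free_alg \<Rightarrow> 'k free_alg) \<Rightarrow> bool"
  where "alg_endo \<phi> \<longleftrightarrow>
    (\<forall>p q. \<phi> (p + q) = \<phi> p + \<phi> q) \<and>
    (\<forall>p q. \<phi> (p * q) = \<phi> p * \<phi> q) \<and>
    (\<forall>c. \<phi> (scal c) = scal c)"

definition Kz_Aut :: "('k::field free_alg \<Rightarrow> 'k free_alg) monoid"
  where "Kz_Aut = \<lparr>carrier = {\<phi>. alg_endo \<phi> \<and> bij \<phi> \<and> \<phi> Z = Z}, mult = (\<circ>), one = id\<rparr>"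

definition subst :: "(letter \<Rightarrow> 'k::field free_alg) \<Rightarrow> 'k free_alg \<Rightarrow> 'k free_alg"
  where "subst \<sigma> p =
    (\<Sum>w \<in> Poly_Mapping.keys p. scal (Poly_Mapping.lookup p w) * prod_list (map \<sigma> (letters w)))"

(* The endomorphism written (f, g) in the literature: x is sent to f, y to g, and z is fixed. *)
definition Kz_endo :: "'k::field free_alg \<Rightarrow> 'k free_alg \<Rightarrow> 'k free_alg \<Rightarrow> 'k free_alg"
  where "Kz_endo f g = subst (\<lambda>v. case v of LX \<Rightarrow> f | LY \<Rightarrow> g | LZ \<Rightarrow> Z)"

definition elementary_linear :: "('k::field free_alg \<Rightarrow> 'k free_alg) set"
  where "elementary_linear = generate Kz_Aut
    ({Kz_endo (scal \<alpha>1 * X) (scal \<alpha>2 * Y) | \<alpha>1 \<alpha>2. \<alpha>1 \<noteq> 0 \<and> \<alpha>2 \<noteq> 0} \<union>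
     {Kz_endo (X + a * Y * b) Y | a b. a \<in> alg_over {LZ} \<and> b \<in> alg_over {LZ}} \<union>
     {Kz_endo X (Y + a * X * b) | a b. a \<in> alg_over {LZ} \<and> b \<in> alg_over {LZ}})"

definition triangular :: "('k::field free_alg \<Rightarrow> 'k free_alg) set"
  where "triangular =
    {Kz_endo (scal \<alpha>1 * X + f1) (scal \<alpha>2 * Y + f2) | \<alpha>1 \<alpha>2 f1 f2.
       \<alpha>1 \<noteq> 0 \<and> \<alpha>2 \<noteq> 0 \<and> f1 \<in> alg_over {LY, LZ} \<and> f2 \<in> alg_over {LZ}}"

definition tame :: "('k::field free_alg \<Rightarrow> 'k free_alg) \<Rightarrow> bool"
  where "tame \<phi> \<longleftrightarrow> \<phi> \<in> generate Kz_Aut (elementary_linear \<union> triangular)"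

definition wild :: "('k::field free_alg \<Rightarrow> 'k free_alg) \<Rightarrow> bool"
  where "wild \<phi> \<longleftrightarrow> \<phi> \<in> carrier Kz_Aut \<and> \<not> tame \<phi>"

definition anick :: "'k::field free_alg \<Rightarrow> 'k free_alg"
  where "anick = Kz_endo (X + Z * (X * Z - Z * Y)) (Y + (X * Z - Z * Y) * Z)"


lemma scal_simps: "scal a * scal b = scal (a * b)" "scal 1 = 1"
  by (simp_all add: scal_def mult_single)

lemma letters_plus: "letters (u + v) = letters u @ letters v"
  by (simp add: plus_word_def)

lemma subst_superset:
  assumes "finite A" "Poly_Mapping.keys p \<subseteq> A"
  shows "subst \<sigma> p = (\<Sum>w \<in> A. scal (Poly_Mapping.lookup p w) * prod_list (map \<sigma> (letters w)))"
  unfolding subst_def using assms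
  by (intro sum.mono_neutral_left) (auto simp: in_keys_iff scal_def)

lemma subst_add: "subst \<sigma> (p + q) = subst \<sigma> p + subst \<sigma> q"
proof -
  let ?A = "Poly_Mapping.keys p \<union> Poly_Mapping.keys q"
  have "Poly_Mapping.keys (p + q) \<subseteq> ?A" by (rule Poly_Mapping.keys_add)
  then show ?thesis
    by (simp add: subst_superset[where A = ?A] lookup_add scal_def single_add
        distrib_right sum.distrib)
qed

lemma subst_single:
  "subst \<sigma> (Poly_Mapping.single w c) = scal c * prod_list (map \<sigma> (letters w))"
  by (subst subst_superset[where A = "{w}"]) auto

lemma free_alg_induct [case_names single add]:
  fixes p :: "'k::field free_alg"
  assumes single: "\<And>w c. P (Poly_Mapping.single w c)"
    and add: "\<And>p q. P p \<Longrightarrow> P q \<Longrightarrow> P (p + q)"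
  shows "P p"
proof (induction p rule: update_induct)
  case const
  show ?case using single[of 0 0] by simp
next
  case (update p w c)
  have "Poly_Mapping.update w c p = p + Poly_Mapping.single w c"
    using update.hyps
    by (intro poly_mapping_eqI) (auto simp: lookup_update lookup_add lookup_single in_keys_iff)
  then show ?case using add[OF update.IH single] by simp
qed

lemma scal_mult_commute: "scal c * p = p * scal c"
  by (induction p rule: free_alg_induct)
    (simp_all add: scal_def mult_single mult.commute distrib_left distrib_right)

lemma subst_mult: "subst \<sigma> (p * q) = subst \<sigma> p * subst \<sigma> q"
proof (induction p rule: free_alg_induct)
  case (single u a)
  show ?case
  proof (induction q rule: free_alg_induct)
    case (single v b)
    let ?m = "\<lambda>w. prod_list (map \<sigma> (letters w))"
    have "subst \<sigma> (Poly_Mapping.single u a * Poly_Mapping.single v b)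
        = (scal a * scal b) * (?m u * ?m v)"
      by (simp add: mult_single subst_single letters_plus scal_simps)
    also have "\<dots> = scal a * (scal b * ?m u) * ?m v"
      by (simp only: mult.assoc)
    also have "\<dots> = scal a * (?m u * scal b) * ?m v"
      by (simp only: scal_mult_commute[of b "?m u"])
    also have "\<dots> = (scal a * ?m u) * (scal b * ?m v)"
      by (simp only: mult.assoc)
    finally show ?case by (simp add: subst_single)
  qed (simp add: distrib_left subst_add)
qed (simp add: distrib_right subst_add)

lemma alg_endo_subst: "alg_endo (subst \<sigma>)"
  unfolding alg_endo_def
  by (auto simp: subst_add subst_mult) (simp add: scal_def subst_single zero_word_def)

lemma subst_gen: "subst \<sigma> (gen v) = \<sigma> v"
  by (simp add: gen_def subst_single scal_def)

lemma single_word: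
  fixes c :: "'k::field"
  shows "Poly_Mapping.single w c = scal c * prod_list (map gen (letters w))"
proof -
  have "prod_list (map gen vs) = Poly_Mapping.single (Word vs) (1::'k::field)" for vs
    by (induction vs) (simp_all add: gen_def mult_single plus_word_def flip: zero_word_def)
  then show ?thesis by (simp add: scal_def mult_single)
qed

lemma alg_endo_eqI:
  assumes "alg_endo \<phi>" "alg_endo \<psi>" "\<And>v. \<phi> (gen v) = \<psi> (gen v)"
  shows "\<phi> = \<psi>"
proof
  fix p
  show "\<phi> p = \<psi> p"
  proof (induction p rule: free_alg_induct)
    case (single w c)
    have one: "scal 1 = 1" by (simp add: scal_def)
    have "\<phi> (prod_list (map gen vs)) = \<psi> (prod_list (map gen vs))" for vs
    proof (induction vs)
      case Nil
      then show ?case using assms(1,2) one unfolding alg_endo_def by (metis list.map(1) prod_list.Nil)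
    qed (use assms in \<open>simp add: alg_endo_def\<close>)
    then show ?case using assms(1,2) unfolding alg_endo_def by (simp add: single_word)
  next
    case (add p q)
    then show ?case using assms(1,2) unfolding alg_endo_def by simp
  qed
qed

lemma Kz_endo:
  shows "alg_endo (Kz_endo f g)"
    and "Kz_endo f g X = f" "Kz_endo f g Y = g" "Kz_endo f g Z = Z"
  by (simp_all add: Kz_endo_def alg_endo_subst subst_gen)

lemma alg_endo_inv:
  assumes "alg_endo \<phi>" "bij \<phi>"
  shows "alg_endo (inv_into UNIV \<phi>)"
proof -
  have inj: "inj \<phi>" and r: "\<And>p. \<phi> (inv_into UNIV \<phi> p) = p"
    using assms(2) by (auto simp: bij_is_inj bij_is_surj surj_f_inv_f)
  show ?thesis
    unfolding alg_endo_def
    by (intro conjI allI; rule injD[OF inj]) (use assms(1) in \<open>simp_all add: alg_endo_def r\<close>)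
qed

lemma group_Kz_Aut: "group Kz_Aut"
proof (rule groupI)
  fix \<phi> :: "'k::field free_alg \<Rightarrow> 'k free_alg"
  assume "\<phi> \<in> carrier Kz_Aut"
  then have \<phi>: "alg_endo \<phi>" "bij \<phi>" "\<phi> Z = Z" by (auto simp: Kz_Aut_def)
  then have "inv_into UNIV \<phi> Z = Z" by (metis bij_inv_eq_iff)
  with \<phi> have "inv_into UNIV \<phi> \<in> carrier Kz_Aut"
    by (simp add: Kz_Aut_def alg_endo_inv bij_imp_bij_inv)
  moreover have "inv_into UNIV \<phi> \<circ> \<phi> = id" using \<phi>(2) by (simp add: bij_is_inj)
  ultimately show "\<exists>\<psi>\<in>carrier Kz_Aut. \<psi> \<otimes>\<^bsub>Kz_Aut\<^esub> \<phi> = \<one>\<^bsub>Kz_Aut\<^esub>"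
    by (auto simp: Kz_Aut_def)
qed (auto simp: Kz_Aut_def alg_endo_def bij_comp)

lemma alg_endo_simps:
  assumes "alg_endo \<phi>"
  shows "\<phi> (p + q) = \<phi> p + \<phi> q" "\<phi> (p - q) = \<phi> p - \<phi> q"
    "\<phi> (p * q) = \<phi> p * \<phi> q" "\<phi> (scal c) = scal c"
proof -
  show add: "\<phi> (p + q) = \<phi> p + \<phi> q" for p q using assms by (simp add: alg_endo_def)
  show "\<phi> (p - q) = \<phi> p - \<phi> q" using add[of "p - q" q] by (simp add: algebra_simps)
qed (use assms in \<open>simp_all add: alg_endo_def\<close>)

lemma alg_endo_id: "alg_endo id"
  by (simp add: alg_endo_def)

lemma alg_endo_comp: "alg_endo \<phi> \<Longrightarrow> alg_endo \<psi> \<Longrightarrow> alg_endo (\<phi> \<circ> \<psi>)"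
  by (simp add: alg_endo_def)

lemma alg_endo_cong_alg_over:
  assumes "alg_endo \<phi>" "alg_endo \<psi>" "p \<in> alg_over S"
    and "\<And>v. v \<in> S \<Longrightarrow> \<phi> (gen v) = \<psi> (gen v)"
  shows "\<phi> p = \<psi> p"
proof -
  have eq: "\<chi> = subst (\<chi> \<circ> gen)" if "alg_endo \<chi>" for \<chi> :: "'a free_alg \<Rightarrow> 'a free_alg"
    by (rule alg_endo_eqI[OF that alg_endo_subst]) (simp add: subst_gen)
  have "subst (\<phi> \<circ> gen) p = subst (\<psi> \<circ> gen) p"
    unfolding subst_def
  proof (intro sum.cong refl)
    fix w assume "w \<in> Poly_Mapping.keys p"
    then have "set (letters w) \<subseteq> S" using assms(3) by (auto simp: alg_over_def)
    then have "map (\<phi> \<circ> gen) (letters w) = map (\<psi> \<circ> gen) (letters w)"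
      using assms(4) by auto
    then show "scal (Poly_Mapping.lookup p w) * prod_list (map (\<phi> \<circ> gen) (letters w)) =
      scal (Poly_Mapping.lookup p w) * prod_list (map (\<psi> \<circ> gen) (letters w))" by (simp only:)
  qed
  then show ?thesis using eq[OF assms(1)] eq[OF assms(2)] by simp
qed

lemma Kz_endo_in_Kz_Aut:
  assumes "alg_endo \<psi>" "\<psi> Z = Z" "\<psi> f = X" "\<psi> g = Y"
    "Kz_endo f g (\<psi> X) = X" "Kz_endo f g (\<psi> Y) = Y"
  shows "Kz_endo f g \<in> carrier Kz_Aut"
proof -
  let ?\<phi> = "Kz_endo f g"
  have "(?\<phi> \<circ> \<psi>) (gen v) = id (gen v)" "(\<psi> \<circ> ?\<phi>) (gen v) = id (gen v)" for v
    using assms by (cases v; simp add: Kz_endo)+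
  then have "?\<phi> \<circ> \<psi> = id" "\<psi> \<circ> ?\<phi> = id"
    by (auto intro!: alg_endo_eqI alg_endo_comp alg_endo_id Kz_endo(1) assms(1))
  then have "bij ?\<phi>" using o_bij by blast
  then show ?thesis by (simp add: Kz_Aut_def Kz_endo)
qed

lemma scal_cancel: "a \<noteq> 0 \<Longrightarrow> scal a * (scal (inverse a) * p) = p"
  "a \<noteq> 0 \<Longrightarrow> scal (inverse a) * (scal a * p) = p"
  by (simp_all add: scal_simps flip: mult.assoc)

lemma triangular_subset: "triangular \<subseteq> carrier Kz_Aut"
proof
  fix \<phi> :: "'k::field free_alg \<Rightarrow> 'k free_alg"
  assume "\<phi> \<in> triangular"
  then obtain a b :: 'k and f1 f2 where \<phi>: "\<phi> = Kz_endo (scal a * X + f1) (scal b * Y + f2)"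
    and nz: "a \<noteq> 0" "b \<noteq> 0" and f1: "f1 \<in> alg_over {LY, LZ}" and f2: "f2 \<in> alg_over {LZ}"
    by (auto simp: triangular_def)
  define \<rho> where "\<rho> = Kz_endo X (scal (inverse b) * (Y - f2))"
  define \<psi> where "\<psi> = Kz_endo (scal (inverse a) * (X - \<rho> f1)) (scal (inverse b) * (Y - f2))"
  have endo: "alg_endo \<phi>" "alg_endo \<rho>" "alg_endo \<psi>"
    by (simp_all add: \<phi> \<rho>_def \<psi>_def Kz_endo)
  have \<phi>v: "\<phi> X = scal a * X + f1" "\<phi> Y = scal b * Y + f2" "\<phi> Z = Z"
    by (simp_all add: \<phi> Kz_endo)
  have \<rho>v: "\<rho> X = X" "\<rho> Y = scal (inverse b) * (Y - f2)" "\<rho> Z = Z"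
    by (simp_all add: \<rho>_def Kz_endo)
  have \<psi>v: "\<psi> X = scal (inverse a) * (X - \<rho> f1)" "\<psi> Y = scal (inverse b) * (Y - f2)" "\<psi> Z = Z"
    by (simp_all add: \<psi>_def Kz_endo)
  have fix_f2: "\<chi> f2 = f2" if "alg_endo \<chi>" "\<chi> Z = Z" for \<chi>
    using alg_endo_cong_alg_over[OF that(1) alg_endo_id f2] that(2) by simp
  note \<phi>f2 = fix_f2[OF endo(1) \<phi>v(3)] and \<psi>f2 = fix_f2[OF endo(3) \<psi>v(3)]
  have \<psi>f1: "\<psi> f1 = \<rho> f1"
    by (rule alg_endo_cong_alg_over[OF endo(3,2) f1]) (auto simp: \<rho>v \<psi>v)
  have \<phi>Y: "\<phi> (scal (inverse b) * (Y - f2)) = Y"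
    using nz by (simp add: alg_endo_simps[OF endo(1)] \<phi>f2 \<phi>v scal_cancel)
  have "(\<phi> \<circ> \<rho>) f1 = id f1"
    by (rule alg_endo_cong_alg_over[OF alg_endo_comp[OF endo(1,2)] alg_endo_id f1])
      (auto simp: \<rho>v \<phi>Y \<phi>v)
  then have \<phi>X: "\<phi> (scal (inverse a) * (X - \<rho> f1)) = X"
    using nz by (simp add: alg_endo_simps[OF endo(1)] \<phi>v scal_cancel)
  have \<psi>fg: "\<psi> (scal a * X + f1) = X" "\<psi> (scal b * Y + f2) = Y"
    using nz by (simp_all add: alg_endo_simps[OF endo(3)] \<psi>v \<psi>f1 \<psi>f2 scal_cancel)
  show "\<phi> \<in> carrier Kz_Aut"
    unfolding \<phi>
    by (rule Kz_endo_in_Kz_Aut[OF endo(3) \<psi>v(3) \<psi>fg]; simp only: \<psi>v \<phi>X \<phi>Y flip: \<phi>)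
qed

lemma elementary_linear_subset: "elementary_linear \<subseteq> carrier Kz_Aut"
proof -
  have d: "Kz_endo (scal \<alpha>1 * X) (scal \<alpha>2 * Y) \<in> carrier Kz_Aut"
    if "\<alpha>1 \<noteq> 0" "\<alpha>2 \<noteq> 0" for \<alpha>1 \<alpha>2 :: "'k::field"
    by (rule Kz_endo_in_Kz_Aut
        [where \<psi> = "Kz_endo (scal (inverse \<alpha>1) * X) (scal (inverse \<alpha>2) * Y)"])
      (simp_all add: alg_endo_simps[OF Kz_endo(1)] Kz_endo scal_cancel that)
  have fix_ab: "Kz_endo f g a = a" if "a \<in> alg_over {LZ}" for f g a :: "'k::field free_alg"
    using alg_endo_cong_alg_over[OF Kz_endo(1) alg_endo_id that] by (auto simp: Kz_endo)
  have x: "Kz_endo (X + a * Y * b) Y \<in> carrier Kz_Aut"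
    if "a \<in> alg_over {LZ}" "b \<in> alg_over {LZ}" for a b :: "'k::field free_alg"
    by (rule Kz_endo_in_Kz_Aut[where \<psi> = "Kz_endo (X - a * Y * b) Y"])
      (simp_all add: alg_endo_simps[OF Kz_endo(1)] Kz_endo fix_ab that)
  have y: "Kz_endo X (Y + a * X * b) \<in> carrier Kz_Aut"
    if "a \<in> alg_over {LZ}" "b \<in> alg_over {LZ}" for a b :: "'k::field free_alg"
    by (rule Kz_endo_in_Kz_Aut[where \<psi> = "Kz_endo X (Y - a * X * b)"])
      (simp_all add: alg_endo_simps[OF Kz_endo(1)] Kz_endo fix_ab that)
  show ?thesis
    unfolding elementary_linear_def
    by (intro group.generate_incl[OF group_Kz_Aut] Un_least subsetI;
        elim CollectE exE conjE; simp only: d x y not_False_eq_True)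
qed

end

(* Read z on the left of x or y as z1 and z on the right as z2. Linearising a K[z]-automorphism
   in x and y then gives a 2 x 2 matrix over K[z1, z2], and by the chain rule the matrix of a tame
   automorphism is a product of elementary and invertible diagonal matrices: this holds for the
   linear generators, and the matrix of a triangular automorphism is triangular with constant
   diagonal. The matrix of the Anick automorphism is Cohn's matrix with rows (1 + z1 z2, - z1^2)
   and (z2^2, 1 - z1 z2), which is not such a product: running the Euclidean algorithm on its first
   column would require that one of the leading monomials z1 z2 and z2^2 divides the other. *)

theory Submission
  imports Defs "HOL-Computational_Algebra.Polynomial"
begin

section \<open>The ring K[z1, z2] and its constants\<close>

text \<open>K[z1, z2] is encoded as polynomials in z1 (outer) over polynomials in z2 (inner), so
  that \<open>degree\<close> and \<open>lead_coeff\<close> read off the lexicographically leading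
  monomial.\<close>

definition cst :: "'k::field \<Rightarrow> 'k poly poly"
  where "cst c = [:[:c:]:]"

lemma cst_simps:
  "cst 0 = 0" "cst 1 = 1" "cst a + cst b = cst (a + b)" "cst a - cst b = cst (a - b)"
  "cst a * cst b = cst (a * b)"
  by (simp_all add: cst_def one_pCons)

lemma cst_hom:
  "cst (a + b) = cst a + cst b" "cst (a - b) = cst a - cst b" "cst (a * b) = cst a * cst b"
  by (simp_all add: cst_simps)

lemma cst_mult_left: "cst a * (cst b * p) = cst (a * b) * p"
  by (simp flip: cst_simps(5) add: mult.assoc)

lemma cst_eq_0_iff: "cst c = 0 \<longleftrightarrow> c = 0"
  by (simp add: cst_def)

lemma cst_mult: "cst c * p = smult [:c:] p"
  by (simp add: cst_def)

text \<open>With the next lemma, this lets constants be absorbed into a quotient without making it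
  constant.\<close>

lemma range_cst_add_iff: "q + cst c \<in> range cst \<longleftrightarrow> q \<in> range cst"
proof
  assume "q + cst c \<in> range cst"
  then obtain d where "q + cst c = cst d" by blast
  then have "q = cst (d - c)" by (simp add: algebra_simps flip: cst_simps(4))
  then show "q \<in> range cst" by blast
qed (auto simp: cst_simps)

lemma range_cst_mult_iff:
  assumes "c \<noteq> 0"
  shows "cst c * q \<in> range cst \<longleftrightarrow> q \<in> range cst"
proof
  assume "cst c * q \<in> range cst"
  then obtain d where "cst c * q = cst d" by blast
  then have "cst (inverse c) * (cst c * q) = cst (inverse c * d)" by (simp add: cst_simps)
  then have "q = cst (inverse c * d)" using assms by (simp add: cst_mult_left cst_simps)
  then show "q \<in> range cst" by blast
qed (auto simp: cst_simps)

section \<open>Euclidean pairs and their closure under elementary operations\<close>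

text \<open>The pairs on which the Euclidean algorithm ends in a nonzero constant, with every quotient
  non-constant; the last condition makes degrees strictly increase from step to step.\<close>

inductive euclid :: "'k::field poly poly \<Rightarrow> 'k poly poly \<Rightarrow> bool" where
  base: "c \<noteq> 0 \<Longrightarrow> euclid (cst c) 0"
| step: "euclid a b \<Longrightarrow> k \<noteq> 0 \<Longrightarrow> l \<noteq> 0 \<Longrightarrow> q \<notin> range cst \<Longrightarrow>
    euclid (a * q + cst k * b) (cst l * a)"

text \<open>The last division step absorbs both scalars: \<open>s\<close> goes into its quotient and
  \<open>k\<close>, \<open>t\<close> into \<open>l\<close>.\<close>

lemma euclid_scale:
  assumes "euclid a b" "s \<noteq> 0" "t \<noteq> 0"
  shows "euclid (cst s * a) (cst t * b)"
  using assms(1)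
proof cases
  case (base c)
  then show ?thesis using assms euclid.base[of "s * c"] by (simp add: cst_simps)
next
  case (step e f k l q)
  have "cst s * q \<notin> range cst"
    using step(6) assms(2) by (simp add: range_cst_mult_iff)
  then have "euclid (e * (cst s * q) + cst (s * k) * f) (cst (t * l) * e)"
    using step assms by (intro euclid.step) auto
  then show ?thesis using step by (simp add: algebra_simps cst_hom)
qed

text \<open>Allowing an invertible constant matrix absorbs the constant quotients, which makes the set
  closed under all elementary matrices.\<close>

definition euclid_orbit :: "'k::field poly poly \<Rightarrow> 'k poly poly \<Rightarrow> bool"
  where "euclid_orbit a b \<longleftrightarrow> (\<exists>e f \<alpha> \<beta> \<gamma> \<delta>. euclid e f \<and> \<alpha> * \<delta> - \<beta> * \<gamma> \<noteq> 0 \<and>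
    a = cst \<alpha> * e + cst \<beta> * f \<and> b = cst \<gamma> * e + cst \<delta> * f)"

lemma euclid_orbitI:
  "euclid e f \<Longrightarrow> \<alpha> * \<delta> - \<beta> * \<gamma> \<noteq> 0 \<Longrightarrow> a = cst \<alpha> * e + cst \<beta> * f \<Longrightarrow> b = cst \<gamma> * e + cst \<delta> * f
    \<Longrightarrow> euclid_orbit a b"
  unfolding euclid_orbit_def by blast

lemma euclid_orbit_euclid: "euclid e f \<Longrightarrow> euclid_orbit e f"
  by (rule euclid_orbitI[where \<alpha> = 1 and \<beta> = 0 and \<gamma> = 0 and \<delta> = 1]) (simp_all add: cst_simps)

lemma euclid_orbit_swap_iff: "euclid_orbit b a \<longleftrightarrow> euclid_orbit a b"
proof -
  have "euclid_orbit b a" if ab: "euclid_orbit a b" for a b :: "'k::field poly poly"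
  proof -
    obtain e f \<alpha> \<beta> \<gamma> \<delta> where "euclid e f" "\<alpha> * \<delta> - \<beta> * \<gamma> \<noteq> 0"
      "a = cst \<alpha> * e + cst \<beta> * f" "b = cst \<gamma> * e + cst \<delta> * f"
      using ab unfolding euclid_orbit_def by blast
    then show ?thesis
      by (intro euclid_orbitI[where e = e and f = f and \<alpha> = \<gamma> and \<beta> = \<delta> and \<gamma> = \<alpha> and \<delta> = \<beta>])
        (auto simp: algebra_simps)
  qed
  then show ?thesis by blast
qed

lemma euclid_orbit_linear:
  assumes "euclid_orbit a b" "s \<noteq> 0" "t \<noteq> 0"
  shows "euclid_orbit (cst s * a + cst u * b) (cst t * b)"
proof -
  obtain e f \<alpha> \<beta> \<gamma> \<delta> where ef: "euclid e f" "\<alpha> * \<delta> - \<beta> * \<gamma> \<noteq> 0"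
    "a = cst \<alpha> * e + cst \<beta> * f" "b = cst \<gamma> * e + cst \<delta> * f"
    using assms(1) unfolding euclid_orbit_def by blast
  have "(s * \<alpha> + u * \<gamma>) * (t * \<delta>) - (s * \<beta> + u * \<delta>) * (t * \<gamma>) = s * t * (\<alpha> * \<delta> - \<beta> * \<gamma>)"
    by (simp add: algebra_simps)
  with ef assms(2,3) show ?thesis
    by (intro euclid_orbitI[OF ef(1), where \<alpha> = "s * \<alpha> + u * \<gamma>" and \<beta> = "s * \<beta> + u * \<delta>"
          and \<gamma> = "t * \<gamma>" and \<delta> = "t * \<delta>"])
      (simp_all add: algebra_simps cst_hom)
qed

text \<open>A constant \<open>q\<close> only changes the constant matrix. Otherwise, if
  \<open>b\<close> involves \<open>e\<close>, the shear is one more division step, on the pair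
  \<open>b\<close>, \<open>f\<close>; if not, it modifies the last quotient or cancels the last
  step.\<close>

lemma euclid_orbit_shear:
  assumes "euclid_orbit a b"
  shows "euclid_orbit (a + q * b) b"
proof (cases "q \<in> range cst")
  case True
  then show ?thesis using euclid_orbit_linear[OF assms, of 1 1] by (auto simp: cst_simps)
next
  case q: False
  obtain e f \<alpha> \<beta> \<gamma> \<delta> where ef: "euclid e f" and det: "\<alpha> * \<delta> - \<beta> * \<gamma> \<noteq> 0"
    and a: "a = cst \<alpha> * e + cst \<beta> * f" and b: "b = cst \<gamma> * e + cst \<delta> * f"
    using assms unfolding euclid_orbit_def by blast
  show ?thesis
  proof (cases "\<gamma> = 0")
    case False
    \<comment> \<open>Eliminating \<open>e\<close> from \<open>a\<close> by means of
      \<open>b\<close> leaves \<kappa> times \<open>f\<close>; \<kappa> is minus the determinant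
      divided by \<gamma>.\<close>
    define \<kappa> where "\<kappa> = \<beta> - \<alpha> / \<gamma> * \<delta>"
    have \<kappa>: "\<kappa> \<noteq> 0" using det False by (simp add: \<kappa>_def field_simps)
    have "cst \<alpha> = cst (\<alpha> / \<gamma>) * cst \<gamma>"
      using False by (simp add: cst_simps)
    moreover have "cst \<beta> = cst \<kappa> + cst (\<alpha> / \<gamma>) * cst \<delta>"
      by (simp add: \<kappa>_def cst_simps)
    ultimately have "a = cst (\<alpha> / \<gamma>) * b + cst \<kappa> * f"
      by (simp add: a b algebra_simps)
    then have ab: "a + q * b = b * (q + cst (\<alpha> / \<gamma>)) + cst \<kappa> * f"
      by (simp add: algebra_simps)
    \<comment> \<open>Since \<open>f\<close> is a constant multiple of the divisor of the last step,
      replacing \<open>e\<close> by \<open>b\<close> only rescales and shifts the last quotient by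
      constants.\<close>
    have "euclid b f"
      using ef
    proof cases
      case (base c)
      then show ?thesis using False euclid.base[of "\<gamma> * c"] by (simp add: b cst_simps)
    next
      case (step e' f' k l q')
      have "cst \<gamma> * q' + cst (\<delta> * l) \<notin> range cst"
        using step(6) False by (simp only: range_cst_add_iff range_cst_mult_iff not_False_eq_True)
      then have "euclid (e' * (cst \<gamma> * q' + cst (\<delta> * l)) + cst (\<gamma> * k) * f') (cst l * e')"
        using step False by (intro euclid.step) auto
      then show ?thesis using step by (simp add: b algebra_simps cst_hom)
    qed
    then have "euclid (b * (q + cst (\<alpha> / \<gamma>)) + cst \<kappa> * f) (cst 1 * b)"
      using \<kappa> q by (intro euclid.step) (auto simp: range_cst_add_iff)
    then show ?thesis by (simp add: ab cst_simps euclid_orbit_euclid)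
  next
    case True
    then have nz: "\<alpha> \<noteq> 0" "\<delta> \<noteq> 0" using det by auto
    show ?thesis
      using ef
    proof cases
      case (base c)
      then show ?thesis using assms True by (simp add: b cst_simps)
    next
      case (step e' f' k l q')
      \<comment> \<open>Here \<open>b\<close> is a constant multiple of \<open>e'\<close>, so the
        shear merges with the last quotient.\<close>
      define s where "s = cst \<alpha> * q' + cst (\<beta> * l) + cst (\<delta> * l) * q"
      have ab: "a + q * b = e' * s + cst (\<alpha> * k) * f'" "b = cst (\<delta> * l) * e'"
        using step True by (simp_all add: a b s_def algebra_simps cst_hom cst_simps(1))
      show ?thesis
      proof (cases "s \<in> range cst")
        \<comment> \<open>A constant \<open>s\<close> cancels the last division: the representative
          becomes \<open>e'\<close>, \<open>f'\<close>, with a matrix of determinant - \<alpha>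
          \<delta> k l.\<close>
        case True
        then obtain c where "s = cst c" by blast
        with ab have "a + q * b = cst c * e' + cst (\<alpha> * k) * f'" "b = cst (\<delta> * l) * e' + cst 0 * f'"
          by (simp_all only: mult.commute cst_simps(1) mult_zero_left add_0_right)
        then show ?thesis using step nz by (intro euclid_orbitI) auto
      next
        case False
        then have "euclid (e' * s + cst (\<alpha> * k) * f') (cst (\<delta> * l) * e')"
          using step nz by (intro euclid.step) auto
        then show ?thesis by (intro euclid_orbit_euclid) (simp only: ab[symmetric])
      qed
    qed
  qed
qed

text \<open>This is how a triangular automorphism will act on the pair \<open>d X\<close>,
  \<open>d Y\<close>. The converse holds because the shear and the scaling can be undone in
  turn.\<close>

lemma euclid_orbit_triangular_iff:
  assumes "s \<noteq> 0" "t \<noteq> 0"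
  shows "euclid_orbit (cst s * a + q * b) (cst t * b) \<longleftrightarrow> euclid_orbit a b"
proof
  assume "euclid_orbit a b"
  from euclid_orbit_linear[OF this assms, of 0]
  have "euclid_orbit (cst s * a) (cst t * b)" by (simp add: cst_simps)
  \<comment> \<open>The second entry is already scaled by \<open>t\<close>, hence the multiplier q /
    t.\<close>
  from euclid_orbit_shear[OF this, of "q * cst (inverse t)"]
  show "euclid_orbit (cst s * a + q * b) (cst t * b)"
    using assms by (simp add: mult.assoc cst_mult_left cst_simps)
next
  assume "euclid_orbit (cst s * a + q * b) (cst t * b)"
  from euclid_orbit_shear[OF this, of "- (q * cst (inverse t))"]
  have "euclid_orbit (cst s * a) (cst t * b)"
    using assms by (simp add: mult.assoc cst_mult_left cst_simps)
  from euclid_orbit_linear[OF this, of "inverse s" "inverse t" 0]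
  show "euclid_orbit a b"
    using assms by (simp add: cst_mult_left cst_simps)
qed

section \<open>Leading monomials and Cohn's column\<close>

text \<open>Comparison of leading monomials for the lexicographic order in which the outer variable
  is the larger one.\<close>

definition deg_less :: "'k::field poly poly \<Rightarrow> 'k poly poly \<Rightarrow> bool"
  where "deg_less a b \<longleftrightarrow> b \<noteq> 0 \<and> (a = 0 \<or> degree a < degree b \<or>
    degree a = degree b \<and> degree (lead_coeff a) < degree (lead_coeff b))"

lemma deg_less_cst_iff: "l \<noteq> 0 \<Longrightarrow> deg_less (cst l * a) b \<longleftrightarrow> deg_less a b"
  by (auto simp: deg_less_def cst_mult)

text \<open>A nonconstant \<open>q\<close> raises the leading monomial of \<open>a\<close>, and
  \<open>b\<close> is too small to cancel that of \<open>a * q\<close>. The proof splits on whether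
  \<open>q\<close> involves z1.\<close>

lemma deg_less_step:
  assumes ba: "deg_less b a" and q: "q \<notin> range cst"
  shows "deg_less a (a * q + b)"
proof -
  have a: "a \<noteq> 0" using ba by (simp add: deg_less_def)
  have q0: "q \<noteq> 0" using q cst_simps(1) by (metis rangeI)
  have ble: "degree b \<le> degree a" using ba by (auto simp: deg_less_def)
  have daq: "degree (a * q) = degree a + degree q" using a q0 by (simp add: degree_mult_eq)
  show ?thesis
  proof (cases "degree q = 0")
    case False
    then have "degree b < degree (a * q)" using ble daq by simp
    then have "degree (a * q + b) = degree (a * q)" by (rule degree_add_eq_left)
    then have "degree a < degree (a * q + b)" using daq False by simp
    then show ?thesis by (auto simp: deg_less_def)
  next
    case True
    then obtain r where r: "q = [:r:]" using degree_eq_zeroE by blast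
    have dr: "degree r > 0"
    proof (rule ccontr)
      assume "\<not> degree r > 0"
      then obtain c where "r = [:c:]" using degree_eq_zeroE by blast
      then show False using q r by (auto simp: cst_def)
    qed
    let ?n = "degree a"
    let ?c = "lead_coeff a * r + coeff b ?n"
    have co: "coeff (a * q + b) ?n = ?c" by (simp add: r)
    have dar: "degree (lead_coeff a * r) = degree (lead_coeff a) + degree r"
      using a dr by (subst degree_mult_eq) auto
    have "degree (coeff b ?n) \<le> degree (lead_coeff a)"
      using ba by (auto simp: deg_less_def coeff_eq_0)
    then have dc: "degree ?c = degree (lead_coeff a) + degree r"
      using dar dr by (subst degree_add_eq_left) auto
    then have "?c \<noteq> 0" using dr by force
    moreover have "degree (a * q + b) \<le> ?n"
      using daq True ble by (intro degree_add_le) auto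
    ultimately have dn: "degree (a * q + b) = ?n"
      using co le_degree[of "a * q + b" ?n] by force
    have "a * q + b \<noteq> 0" using co \<open>?c \<noteq> 0\<close> by (metis coeff_0)
    moreover have "degree (lead_coeff a) < degree (lead_coeff (a * q + b))"
      unfolding dn co dc using dr by simp
    ultimately show ?thesis using dn by (simp add: deg_less_def)
  qed
qed

lemma euclid_deg_less: "euclid a b \<Longrightarrow> deg_less b a"
proof (induction rule: euclid.induct)
  case (base c)
  then show ?case by (simp add: deg_less_def cst_eq_0_iff)
next
  case (step a b k l q)
  then show ?case using deg_less_step[of "cst k * b" a q] by (simp add: deg_less_cst_iff)
qed

definition z1 :: "'k::field poly poly" where "z1 = [:0, 1:]"

definition z2 :: "'k::field poly poly" where "z2 = [:[:0, 1:]:]"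

text \<open>Comparing leading monomials forces \<open>f\<close> to be a multiple of z2^2; then the
  last division cannot produce the term z1 z2 of \<open>e\<close>.\<close>

lemma cohn_row_not_euclid_orbit: "\<not> euclid_orbit (1 + z1 * z2) (z2 * z2 :: 'k::field poly poly)"
proof
  assume "euclid_orbit (1 + z1 * z2) (z2 * z2 :: 'k poly poly)"
  then obtain e f :: "'k poly poly" and \<alpha> \<beta> \<gamma> \<delta> where ef: "euclid e f"
    and det: "\<alpha> * \<delta> - \<beta> * \<gamma> \<noteq> 0" and rows: "1 + z1 * z2 = cst \<alpha> * e + cst \<beta> * f"
    "z2 * z2 = cst \<gamma> * e + cst \<delta> * f"
    unfolding euclid_orbit_def by blast
  define D where "D = \<alpha> * \<delta> - \<beta> * \<gamma>"
  have D: "D \<noteq> 0" using det D_def by simp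
  \<comment> \<open>The constant matrix is inverted by its adjugate, which gives \<open>e\<close>
    and \<open>f\<close> up to the factor \<open>D\<close>.\<close>
  have "cst \<delta> * (1 + z1 * z2) - cst \<beta> * (z2 * z2) = cst D * e"
    unfolding rows by (simp add: algebra_simps D_def cst_hom)
  moreover have "cst \<alpha> * (z2 * z2) - cst \<gamma> * (1 + z1 * z2) = cst D * f"
    unfolding rows by (simp add: algebra_simps D_def cst_hom)
  ultimately have De: "cst D * e = [:[:\<delta>, 0, - \<beta>:], [:0, \<delta>:]:]"
    and Df: "cst D * f = [:[:- \<gamma>, 0, \<alpha>:], [:0, - \<gamma>:]:]"
    by (simp_all add: z1_def z2_def cst_def one_pCons)
  have less: "deg_less (cst D * f) (cst D * e)"
    using euclid_deg_less[OF euclid_scale[OF ef D D]] .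
  \<comment> \<open>Otherwise \<open>cst D * f\<close> would have leading monomial z1 z2, and
    \<open>cst D * e\<close> contains no larger monomial.\<close>
  have \<gamma>: "\<gamma> = 0"
    using less unfolding De Df deg_less_def by (auto split: if_splits)
  then have \<alpha>\<delta>: "\<alpha> \<noteq> 0" "\<delta> \<noteq> 0" using det by auto
  from ef show False
  proof cases
    case (base c)
    then show ?thesis using Df \<alpha>\<delta> by simp
  next
    case (step a b k l q)
    have "cst (D * l) * a = [:[:0, 0, \<alpha>:]:]"
      using Df step \<gamma> by (simp add: cst_mult_left)
    then have "cst (inverse (D * l)) * (cst (D * l) * a) = cst (inverse (D * l)) * [:[:0, 0, \<alpha>:]:]"
      by simp
    moreover have "inverse (D * l) * (D * l) = 1" using D step by (intro left_inverse) simp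
    ultimately have "a = cst (inverse (D * l)) * [:[:0, 0, \<alpha>:]:]"
      by (simp only: cst_mult_left cst_simps(2) mult_1)
    then have a: "a = [:[:0, 0, \<alpha> / (D * l):]:]"
      by (simp add: cst_def field_simps)
    \<comment> \<open>Being smaller than a multiple of z2^2, \<open>b\<close> is free of z1. So the
      z1-coefficient of \<open>e\<close> comes from \<open>a * q\<close> and is divisible by z2^2,
      whereas it is a nonzero multiple of z2.\<close>
    have "deg_less b a" using euclid_deg_less step by blast
    then have "degree b = 0" by (auto simp: deg_less_def a)
    then have "coeff b 1 = 0" by (simp add: coeff_eq_0)
    then have "coeff (cst D * e) 1 = [:0, 0, D * \<alpha> / (D * l):] * coeff q 1"
      by (simp add: step a cst_mult)
    then have "[:0, \<delta>:] = [:0, 0, D * \<alpha> / (D * l):] * coeff q 1"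
      by (simp add: De)
    then have "coeff [:0, \<delta>:] 1 = coeff ([:0, 0, D * \<alpha> / (D * l):] * coeff q 1) 1" by simp
    then show False using \<alpha>\<delta> by simp
  qed
qed

section \<open>Twisted derivations with values in K[z1, z2]\<close>

text \<open>The maps \<open>f \<mapsto> ((p f, d f), (0, r f))\<close> are algebra homomorphisms into the upper triangular
  matrices over \<open>K[z1, z2]\<close>. Since \<open>p\<close> and \<open>r\<close> are arbitrary on \<open>x\<close> and \<open>y\<close>, the notion is
  stable under composition with every \<open>K[z]\<close>-endomorphism, also one that moves the origin.\<close>

locale Kz_derivation =
  fixes p r d :: "'k::field free_alg \<Rightarrow> 'k poly poly"
  assumes add: "p (f + g) = p f + p g" "r (f + g) = r f + r g" "d (f + g) = d f + d g"
    and mult: "p (f * g) = p f * p g" "r (f * g) = r f * r g" "d (f * g) = p f * d g + d f * r g"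
    and scal: "p (scal c) = cst c" "r (scal c) = cst c" "d (scal c) = 0"
    and Z: "p Z = z1" "r Z = z2" "d Z = 0"
begin

text \<open>This takes the place of the chain rule: composing automorphisms becomes precomposing the
  triple, and no matrices need to be multiplied.\<close>

lemma comp:
  assumes "alg_endo \<phi>" "\<phi> Z = Z"
  shows "Kz_derivation (p \<circ> \<phi>) (r \<circ> \<phi>) (d \<circ> \<phi>)"
  by unfold_locales (simp_all add: alg_endo_simps[OF assms(1)] assms(2) add mult scal Z)

text \<open>By the product rule, \<open>d\<close> of a word is a combination of the values of
  \<open>d\<close> at its letters. It is applied with \<open>b = d Y\<close> on K<y, z>, and with
  \<open>b = 0\<close> on K[z], where divisibility by 0 means vanishing.\<close>

lemma dvd_derivation:
  assumes f: "f \<in> alg_over S" and b: "\<And>v. v \<in> S \<Longrightarrow> b dvd d (gen v)"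
  shows "b dvd d f"
proof -
  have word: "b dvd d (prod_list (map gen vs))" if "set vs \<subseteq> S" for vs
    using that
  proof (induction vs)
    case Nil
    then show ?case using scal(3)[of 1] by (simp add: scal_simps)
  qed (simp add: mult b)
  have "b dvd d (\<Sum>w\<in>A. scal (Poly_Mapping.lookup f w) * prod_list (map gen (letters w)))"
    if "finite A" "A \<subseteq> Poly_Mapping.keys f" for A
    using that
  proof (induction A)
    case empty
    then show ?case using scal(3)[of 0] by (simp add: scal_def)
  next
    case (insert w A)
    then have "set (letters w) \<subseteq> S" using f by (auto simp: alg_over_def)
    with insert show ?case by (simp add: add mult scal word)
  qed
  from this[OF finite_keys order_refl] have "b dvd d (subst gen f)" by (simp add: subst_def)
  moreover have "subst gen f = f"
    using fun_cong[OF alg_endo_eqI[OF alg_endo_subst alg_endo_id, of gen], of f]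
    by (simp add: subst_gen)
  ultimately show ?thesis by simp
qed

end

section \<open>Invariance of the orbit under tame automorphisms\<close>

text \<open>The equivalence makes the property pass to inverses, the quantification over all triples
  makes it pass to products.\<close>

definition row_invariant :: "('k::field free_alg \<Rightarrow> 'k free_alg) \<Rightarrow> bool"
  where "row_invariant \<phi> \<longleftrightarrow> (\<forall>p r d. Kz_derivation p r d \<longrightarrow>
    (euclid_orbit (d (\<phi> X)) (d (\<phi> Y)) \<longleftrightarrow> euclid_orbit (d X) (d Y)))"

lemma row_invariantD:
  "row_invariant \<phi> \<Longrightarrow> Kz_derivation p r d \<Longrightarrow>
    euclid_orbit (d (\<phi> X)) (d (\<phi> Y)) \<longleftrightarrow> euclid_orbit (d X) (d Y)"
  by (auto simp: row_invariant_def)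

lemma row_invariant_generate:
  assumes "\<phi> \<in> generate Kz_Aut H" "H \<subseteq> carrier Kz_Aut" "\<And>h. h \<in> H \<Longrightarrow> row_invariant h"
  shows "row_invariant \<phi>"
  using assms(1)
proof (induction rule: generate.induct)
  case one
  then show ?case by (simp add: row_invariant_def Kz_Aut_def)
next
  case (incl h)
  then show ?case using assms(3) by blast
next
  case (inv h)
  have car: "inv\<^bsub>Kz_Aut\<^esub> h \<in> carrier Kz_Aut" "inv\<^bsub>Kz_Aut\<^esub> h \<otimes>\<^bsub>Kz_Aut\<^esub> h = \<one>\<^bsub>Kz_Aut\<^esub>"
    using inv assms(2) group.inv_closed[OF group_Kz_Aut] group.l_inv[OF group_Kz_Aut] by blast+
  then have \<psi>: "alg_endo (inv\<^bsub>Kz_Aut\<^esub> h)" "(inv\<^bsub>Kz_Aut\<^esub> h) Z = Z" and id: "\<And>f. (inv\<^bsub>Kz_Aut\<^esub> h) (h f) = f"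
    by (auto simp: Kz_Aut_def fun_eq_iff)
  show ?case
    unfolding row_invariant_def
  proof (intro allI impI)
    fix p r d :: "'a free_alg \<Rightarrow> 'a poly poly"
    assume "Kz_derivation p r d"
    \<comment> \<open>Invariance under \<open>h\<close> is used for the triple precomposed with the
      inverse of \<open>h\<close>.\<close>
    from row_invariantD[OF assms(3)[OF inv] Kz_derivation.comp[OF this \<psi>]]
    show "euclid_orbit (d ((inv\<^bsub>Kz_Aut\<^esub> h) X)) (d ((inv\<^bsub>Kz_Aut\<^esub> h) Y)) = euclid_orbit (d X) (d Y)"
      by (simp add: id)
  qed
next
  case (eng g h)
  have "g \<in> carrier Kz_Aut"
    using eng(1) group.generate_incl[OF group_Kz_Aut assms(2)] by blast
  then have g: "alg_endo g" "g Z = Z" by (auto simp: Kz_Aut_def)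
  show ?case
    unfolding row_invariant_def
  proof (intro allI impI)
    fix p r d :: "'a free_alg \<Rightarrow> 'a poly poly"
    assume der: "Kz_derivation p r d"
    \<comment> \<open>Invariance under \<open>h\<close> is used for the triple precomposed with
      \<open>g\<close>, then invariance under \<open>g\<close> for the triple itself.\<close>
    have "euclid_orbit (d (g (h X))) (d (g (h Y))) = euclid_orbit (d X) (d Y)"
      using row_invariantD[OF eng(4) Kz_derivation.comp[OF der g]] row_invariantD[OF eng(3) der]
      by simp
    then show "euclid_orbit (d ((g \<otimes>\<^bsub>Kz_Aut\<^esub> h) X)) (d ((g \<otimes>\<^bsub>Kz_Aut\<^esub> h) Y)) = euclid_orbit (d X) (d Y)"
      by (simp add: Kz_Aut_def)
  qed
qed

lemma row_invariant_triangular: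
  assumes "\<phi> \<in> triangular"
  shows "row_invariant \<phi>"
  unfolding row_invariant_def
proof (intro allI impI)
  fix p r d :: "'a free_alg \<Rightarrow> 'a poly poly"
  assume "Kz_derivation p r d"
  then interpret Kz_derivation p r d .
  obtain a b :: 'a and f1 f2 where \<phi>: "\<phi> = Kz_endo (scal a * X + f1) (scal b * Y + f2)"
    and nz: "a \<noteq> 0" "b \<noteq> 0" and f1: "f1 \<in> alg_over {LY, LZ}" and f2: "f2 \<in> alg_over {LZ}"
    using assms by (auto simp: triangular_def)
  have "d Y dvd d f1" by (rule dvd_derivation[OF f1]) (auto simp: Z)
  then obtain q where q: "d f1 = q * d Y" by (auto simp: dvd_def mult.commute)
  have "0 dvd d f2" by (rule dvd_derivation[OF f2]) (auto simp: Z)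
  then show "euclid_orbit (d (\<phi> X)) (d (\<phi> Y)) = euclid_orbit (d X) (d Y)"
    using nz by (simp add: \<phi> Kz_endo add mult scal q euclid_orbit_triangular_iff)
qed

lemma row_invariant_elementary_linear:
  assumes "\<phi> \<in> elementary_linear"
  shows "row_invariant \<phi>"
proof -
  have diag: "row_invariant (Kz_endo (scal \<alpha>1 * X) (scal \<alpha>2 * Y))" if "\<alpha>1 \<noteq> 0" "\<alpha>2 \<noteq> 0" for \<alpha>1 \<alpha>2 :: 'a
  proof (rule row_invariant_triangular)
    show "Kz_endo (scal \<alpha>1 * X) (scal \<alpha>2 * Y) \<in> triangular"
      unfolding triangular_def using that
      by (intro CollectI exI[of _ \<alpha>1] exI[of _ \<alpha>2] exI[of _ 0]) (simp add: alg_over_def)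
  qed
  \<comment> \<open>Since \<open>d\<close> vanishes on K[z], multiplying by a(z) on the left and
    b(z) on the right becomes multiplication by a(z1) b(z2).\<close>
  have d: "d (a * f * b) = p a * r b * d f"
    if "Kz_derivation p r d" "a \<in> alg_over {LZ}" "b \<in> alg_over {LZ}"
    for p r d and a b f :: "'a free_alg"
  proof -
    interpret Kz_derivation p r d by (rule that(1))
    have "0 dvd d a" "0 dvd d b" using that(2,3) dvd_derivation[of _ "{LZ}" 0] by (auto simp: Z)
    then show ?thesis by (simp add: mult algebra_simps)
  qed
  have shear: "euclid_orbit (a + q * b) b \<longleftrightarrow> euclid_orbit a b"
    "euclid_orbit b (a + q * b) \<longleftrightarrow> euclid_orbit b a" for a b q :: "'a poly poly"
    using euclid_orbit_triangular_iff[of 1 1 a q b] euclid_orbit_swap_iff[of b] by (simp_all add: cst_simps)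
  have shear_x: "row_invariant (Kz_endo (X + a * Y * b) Y)"
    and shear_y: "row_invariant (Kz_endo X (Y + a * X * b))"
    if "a \<in> alg_over {LZ}" "b \<in> alg_over {LZ}" for a b :: "'a free_alg"
  proof -
    have "euclid_orbit (d (X + a * Y * b)) (d Y) = euclid_orbit (d X) (d Y)"
      "euclid_orbit (d X) (d (Y + a * X * b)) = euclid_orbit (d X) (d Y)"
      if "Kz_derivation p r d" for p r d
      by (simp_all only: Kz_derivation.add(3)[OF that] d[OF that \<open>a \<in> _\<close> \<open>b \<in> _\<close>] shear)
    then show "row_invariant (Kz_endo (X + a * Y * b) Y)" "row_invariant (Kz_endo X (Y + a * X * b))"
      unfolding row_invariant_def Kz_endo by blast+
  qed
  define G :: "('a free_alg \<Rightarrow> 'a free_alg) set" where "G =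
    {Kz_endo (scal \<alpha>1 * X) (scal \<alpha>2 * Y) | \<alpha>1 \<alpha>2. \<alpha>1 \<noteq> 0 \<and> \<alpha>2 \<noteq> 0} \<union>
    {Kz_endo (X + a * Y * b) Y | a b. a \<in> alg_over {LZ} \<and> b \<in> alg_over {LZ}} \<union>
    {Kz_endo X (Y + a * X * b) | a b. a \<in> alg_over {LZ} \<and> b \<in> alg_over {LZ}}"
  have gen: "elementary_linear = generate Kz_Aut G"
    by (simp only: elementary_linear_def G_def)
  show ?thesis
  proof (rule row_invariant_generate)
    show "\<phi> \<in> generate Kz_Aut G" using assms gen by simp
    have "generate Kz_Aut G \<subseteq> carrier Kz_Aut"
      unfolding gen[symmetric] by (rule elementary_linear_subset)
    then show "G \<subseteq> carrier Kz_Aut" by (blast intro: generate.incl)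
    show "row_invariant h" if "h \<in> G" for h
      using that diag shear_x shear_y unfolding G_def by blast
  qed
qed

lemma row_invariant_tame:
  assumes "tame \<phi>"
  shows "row_invariant \<phi>"
  using assms unfolding tame_def
  by (rule row_invariant_generate)
    (use elementary_linear_subset triangular_subset row_invariant_elementary_linear
      row_invariant_triangular in blast)+

section \<open>Construction of the derivation along x\<close>

definition linear_extension :: "(letter list \<Rightarrow> 'k::field poly poly) \<Rightarrow> 'k free_alg \<Rightarrow> 'k poly poly"
  where "linear_extension F f =
    (\<Sum>w \<in> Poly_Mapping.keys f. cst (Poly_Mapping.lookup f w) * F (letters w))"

lemma linear_extension_superset:
  assumes "finite A" "Poly_Mapping.keys f \<subseteq> A"
  shows "linear_extension F f = (\<Sum>w \<in> A. cst (Poly_Mapping.lookup f w) * F (letters w))"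
  unfolding linear_extension_def using assms
  by (intro sum.mono_neutral_left) (auto simp: in_keys_iff cst_simps)

lemma linear_extension_add: "linear_extension F (f + g) = linear_extension F f + linear_extension F g"
proof -
  let ?A = "Poly_Mapping.keys f \<union> Poly_Mapping.keys g"
  have "Poly_Mapping.keys (f + g) \<subseteq> ?A" by (rule Poly_Mapping.keys_add)
  then show ?thesis
    by (simp add: linear_extension_superset[where A = ?A] lookup_add distrib_right sum.distrib
        flip: cst_simps(3))
qed

lemma linear_extension_single:
  "linear_extension F (Poly_Mapping.single w c) = cst c * F (letters w)"
  by (subst linear_extension_superset[where A = "{w}"]) auto

text \<open>By bilinearity it suffices to check words. Two summands fit the product rule;
  homomorphisms are the case of a vanishing second summand.\<close>

lemma linear_extension_mult:
  assumes "\<And>u v. F (u @ v) = G u * H v + G' u * H' v"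
  shows "linear_extension F (f * g) =
    linear_extension G f * linear_extension H g + linear_extension G' f * linear_extension H' g"
proof (induction f rule: free_alg_induct)
  case (single u a)
  show ?case
  proof (induction g rule: free_alg_induct)
    case (single v b)
    show ?case
      by (simp add: mult_single linear_extension_single letters_plus assms algebra_simps
          flip: cst_simps(5))
  qed (simp add: distrib_left linear_extension_add algebra_simps)
qed (simp add: distrib_right linear_extension_add algebra_simps)

text \<open>The word z^i x z^j is sent to z1^i z2^j and every other word to 0: the x-derivative at x
  = y = 0, with left and right z kept apart.\<close>

primrec x_derivative :: "letter list \<Rightarrow> 'k::field poly poly" where
  "x_derivative [] = 0"
| "x_derivative (v # vs) = (if v = LZ then z1 else 0) * x_derivative vs +
    (if v = LX then 1 else 0) * prod_list (map (\<lambda>v. if v = LZ then z2 else 0) vs)"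

lemma Kz_derivation_x:
  obtains p r d :: "'k::field free_alg \<Rightarrow> 'k poly poly"
  where "Kz_derivation p r d" "d X = 1" "d Y = 0"
proof -
  define P R where "P = (\<lambda>vs. prod_list (map (\<lambda>v. if v = LZ then z1 else 0) vs) :: 'k poly poly)"
    and "R = (\<lambda>vs. prod_list (map (\<lambda>v. if v = LZ then z2 else 0) vs) :: 'k poly poly)"
  let ?p = "linear_extension P" and ?r = "linear_extension R" and ?d = "linear_extension x_derivative"
  have append: "x_derivative (u @ v) = P u * x_derivative v + x_derivative u * R v" for u v
    by (induction u) (auto simp: P_def R_def algebra_simps)
  have "?p (f * g) = ?p f * ?p g" "?r (f * g) = ?r f * ?r g" for f g
    using linear_extension_mult[of P P P "\<lambda>_. 0" "\<lambda>_. 0" f g]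
      linear_extension_mult[of R R R "\<lambda>_. 0" "\<lambda>_. 0" f g]
    by (simp_all add: P_def R_def linear_extension_def)
  then have "Kz_derivation ?p ?r ?d"
    by unfold_locales (simp_all add: linear_extension_add linear_extension_mult[of x_derivative P x_derivative x_derivative R, OF append]
        scal_def gen_def linear_extension_single zero_word_def, simp_all add: P_def R_def cst_simps)
  moreover have "?d X = 1" "?d Y = 0" by (simp_all add: gen_def linear_extension_single cst_simps)
  ultimately show ?thesis by (rule that)
qed

section \<open>The Anick automorphism is wild\<close>

lemma anick_in_Kz_Aut: "anick \<in> carrier Kz_Aut"
  unfolding anick_def
  \<comment> \<open>Both maps fix xz - zy, so changing the sign of the correction terms gives the
    inverse.\<close>
  by (rule Kz_endo_in_Kz_Aut
      [where \<psi> = "Kz_endo (X - Z * (X * Z - Z * Y)) (Y - (X * Z - Z * Y) * Z)"])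
    (simp_all add: Kz_endo alg_endo_simps[OF Kz_endo(1)], simp_all add: algebra_simps)

theorem mainTheorem2:
  shows "wild (anick :: 'k::field free_alg \<Rightarrow> 'k free_alg)"
proof -
  obtain p r d :: "'k free_alg \<Rightarrow> 'k poly poly"
    where der: "Kz_derivation p r d" and d: "d X = 1" "d Y = 0"
    by (rule Kz_derivation_x)
  interpret Kz_derivation p r d by (rule der)
  have diff: "d (f - g) = d f - d g" for f g using add(3)[of "f - g" g] by simp
  have row: "d (anick X) = 1 + z1 * z2" "d (anick Y) = z2 * z2"
    by (simp_all add: anick_def Kz_endo add diff mult Z d algebra_simps)
  \<comment> \<open>The pair (1, 0) is Euclidean, so invariance would put the first column of Cohn's
    matrix into the orbit.\<close>
  have "euclid_orbit (d X) (d Y)"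
    using euclid_orbit_euclid[OF euclid.base[of 1]] by (simp add: d cst_simps)
  then have "\<not> row_invariant (anick :: 'k free_alg \<Rightarrow> 'k free_alg)"
    using row_invariantD[OF _ der] cohn_row_not_euclid_orbit row by metis
  then show ?thesis using row_invariant_tame anick_in_Kz_Aut by (auto simp: wild_def)
qed

end
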